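(* Let $\mathbb{D}:=\mathbb{Z}[1/2]$. The functor $\mathrm{mid}\colon \mathsf{AffMod}_{\mathbb{D}}\to \mathsf{MCQnd}$ from the category of affine $\mathbb{D}$-modules to the category of medial commutative quandles, defined by $M\mapsto M_{\mathrm{mid}}$ (and sending every morphism to the same underlying set map), is an equivalence of categories.
   Context: A magma $(X,\ast)$ is a set $X$ (possibly empty) with a binary operation $\ast$; homomorphisms are functions preserving the operation. For $x\in X$, let $R_x\colon y\mapsto y\ast x$. A rack is a magma in which every $R_x$ is an automorphism of the magma. A quandle is a rack with $x\ast x=x$ for all $x$. A magma is medial if $(a\ast b)\ast(c\ast d)=(a\ast c)\ast(b\ast d)$ for all $a,b,c,d$, and commutative if $x\ast y=y\ast x$ for all $x,y$. $\mathsf{MCQnd}$ is the category of medial commutative quandles (including the empty one) and quandle homomorphisms. For a ring $R$, $\mathsf{AffMod}_R$ is the category whose objects are the left $R$-modules together with the empty set, and whose morphisms (affine transformations) between modules $M\to N$ are the maps of the form $x\mapsto T(x)+z$ with $T\colon M\to N$ an $R$-module homomorphism and $z\in N$ a constant; there is a unique morphism from the empty set to each object, and no morphism from a module to the empty set. For a $\mathbb{D}$-module $M$, the midpoint quandle $M_{\mathrm{mid}}$ is the set $M$ with operation $x\ast y:=\frac12(x+y)$; the empty set is sent to the empty quandle. *)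

theory Defs
  imports Complex_Main "HOL-Algebra.Module"
begin

text \<open>
  Hom-sets are families indexed by source and target and need not be disjoint, so composition
  takes the three objects involved: for \<open>f \<in> Hom C A B\<close> and \<open>g \<in> Hom C B D\<close>, the composite
  \<open>g \<circ> f\<close> is \<open>Comp C A B D g f\<close>. Likewise the action of a functor on morphisms takes the
  source and the target of the morphism.
\<close>

record ('o, 'm) category =
  Obj :: "'o set"
  Hom :: "'o \<Rightarrow> 'o \<Rightarrow> 'm set"
  Ident :: "'o \<Rightarrow> 'm"
  Comp :: "'o \<Rightarrow> 'o \<Rightarrow> 'o \<Rightarrow> 'm \<Rightarrow> 'm \<Rightarrow> 'm"

locale is_category =
  fixes C :: "('o, 'm) category"
  assumes ident_in_hom: "A \<in> Obj C \<Longrightarrow> Ident C A \<in> Hom C A A"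
    and comp_in_hom:
      "\<lbrakk> A \<in> Obj C; B \<in> Obj C; D \<in> Obj C; f \<in> Hom C A B; g \<in> Hom C B D \<rbrakk>
        \<Longrightarrow> Comp C A B D g f \<in> Hom C A D"
    and comp_ident:
      "\<lbrakk> A \<in> Obj C; B \<in> Obj C; f \<in> Hom C A B \<rbrakk> \<Longrightarrow> Comp C A A B f (Ident C A) = f"
    and ident_comp:
      "\<lbrakk> A \<in> Obj C; B \<in> Obj C; f \<in> Hom C A B \<rbrakk> \<Longrightarrow> Comp C A B B (Ident C B) f = f"
    and comp_assoc:
      "\<lbrakk> A \<in> Obj C; B \<in> Obj C; D \<in> Obj C; E \<in> Obj C;
         f \<in> Hom C A B; g \<in> Hom C B D; h \<in> Hom C D E \<rbrakk>
        \<Longrightarrow> Comp C A D E h (Comp C A B D g f) = Comp C A B E (Comp C B D E h g) f"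

definition iso_in :: "('o, 'm) category \<Rightarrow> 'o \<Rightarrow> 'o \<Rightarrow> 'm \<Rightarrow> bool" where
  "iso_in C A B f \<longleftrightarrow> f \<in> Hom C A B \<and>
     (\<exists>g \<in> Hom C B A. Comp C A B A g f = Ident C A \<and> Comp C B A B f g = Ident C B)"

record ('o, 'm, 'p, 'n) cfunctor =
  omap :: "'o \<Rightarrow> 'p"
  amap :: "'o \<Rightarrow> 'o \<Rightarrow> 'm \<Rightarrow> 'n"

locale is_functor = src: is_category C + tgt: is_category D
  for C :: "('o, 'm) category" and D :: "('p, 'n) category"
    and F :: "('o, 'm, 'p, 'n) cfunctor" +
  assumes omap_closed: "A \<in> Obj C \<Longrightarrow> omap F A \<in> Obj D"
    and amap_closed:
      "\<lbrakk> A \<in> Obj C; B \<in> Obj C; f \<in> Hom C A B \<rbrakk>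
        \<Longrightarrow> amap F A B f \<in> Hom D (omap F A) (omap F B)"
    and amap_ident: "A \<in> Obj C \<Longrightarrow> amap F A A (Ident C A) = Ident D (omap F A)"
    and amap_comp:
      "\<lbrakk> A \<in> Obj C; B \<in> Obj C; E \<in> Obj C; f \<in> Hom C A B; g \<in> Hom C B E \<rbrakk>
        \<Longrightarrow> amap F A E (Comp C A B E g f) =
            Comp D (omap F A) (omap F B) (omap F E) (amap F B E g) (amap F A B f)"

definition id_functor :: "('o, 'm, 'o, 'm) cfunctor" where
  "id_functor = \<lparr> omap = (\<lambda>A. A), amap = (\<lambda>A B f. f) \<rparr>"

definition comp_functor ::
  "('p, 'n, 'q, 'k) cfunctor \<Rightarrow> ('o, 'm, 'p, 'n) cfunctor \<Rightarrow> ('o, 'm, 'q, 'k) cfunctor" where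
  "comp_functor G F =
     \<lparr> omap = (\<lambda>A. omap G (omap F A)),
       amap = (\<lambda>A B f. amap G (omap F A) (omap F B) (amap F A B f)) \<rparr>"

definition natural_iso ::
  "('o, 'm) category \<Rightarrow> ('p, 'n) category \<Rightarrow> ('o, 'm, 'p, 'n) cfunctor \<Rightarrow>
    ('o, 'm, 'p, 'n) cfunctor \<Rightarrow> ('o \<Rightarrow> 'n) \<Rightarrow> bool" where
  "natural_iso C D F G \<eta> \<longleftrightarrow>
     (\<forall>A \<in> Obj C. iso_in D (omap F A) (omap G A) (\<eta> A)) \<and>
     (\<forall>A \<in> Obj C. \<forall>B \<in> Obj C. \<forall>f \<in> Hom C A B.
        Comp D (omap F A) (omap F B) (omap G B) (\<eta> B) (amap F A B f) =
        Comp D (omap F A) (omap G A) (omap G B) (amap G A B f) (\<eta> A))"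

definition is_equivalence ::
  "('o, 'm) category \<Rightarrow> ('p, 'n) category \<Rightarrow> ('o, 'm, 'p, 'n) cfunctor \<Rightarrow> bool" where
  "is_equivalence C D F \<longleftrightarrow> is_functor C D F \<and>
     (\<exists>G. is_functor D C G \<and>
        (\<exists>\<eta>. natural_iso C C id_functor (comp_functor G F) \<eta>) \<and>
        (\<exists>\<epsilon>. natural_iso D D (comp_functor F G) id_functor \<epsilon>))"

record 'a magma = "'a partial_object" +
  qop :: "'a \<Rightarrow> 'a \<Rightarrow> 'a"  (infixl \<open>\<star>\<index>\<close> 70)

locale is_magma =
  fixes X :: "'a magma" (structure)
  assumes qop_closed: "\<lbrakk> x \<in> carrier X; y \<in> carrier X \<rbrakk> \<Longrightarrow> x \<star> y \<in> carrier X"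

definition magma_hom :: "'a magma \<Rightarrow> 'b magma \<Rightarrow> ('a \<Rightarrow> 'b) set" where
  "magma_hom X Y = {f \<in> carrier X \<rightarrow> carrier Y.
     \<forall>x \<in> carrier X. \<forall>y \<in> carrier X. f (x \<star>\<^bsub>X\<^esub> y) = f x \<star>\<^bsub>Y\<^esub> f y}"

definition magma_aut :: "'a magma \<Rightarrow> ('a \<Rightarrow> 'a) set" where
  "magma_aut X = {f \<in> magma_hom X X. bij_betw f (carrier X) (carrier X)}"

locale rack = is_magma +
  assumes right_mult_aut: "x \<in> carrier X \<Longrightarrow> (\<lambda>y. y \<star> x) \<in> magma_aut X"

locale quandle = rack +
  assumes qop_idem: "x \<in> carrier X \<Longrightarrow> x \<star> x = x"

locale medial_commutative_quandle = quandle +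
  assumes medial:
      "\<lbrakk> a \<in> carrier X; b \<in> carrier X; c \<in> carrier X; d \<in> carrier X \<rbrakk>
        \<Longrightarrow> (a \<star> b) \<star> (c \<star> d) = (a \<star> c) \<star> (b \<star> d)"
    and commutative: "\<lbrakk> x \<in> carrier X; y \<in> carrier X \<rbrakk> \<Longrightarrow> x \<star> y = y \<star> x"

text \<open>
  The type \<open>'a\<close> plays the role of the universe: objects have a subset of \<open>'a\<close> as underlying
  set. Morphisms are set maps between carriers, represented by functions that are
  \<open>undefined\<close> outside the domain. Two objects whose operations differ only outside the carrier
  are formally distinct, but isomorphic via the identity map.
\<close>

definition MCQnd :: "('a magma, 'a \<Rightarrow> 'a) category" where
  "MCQnd =
     \<lparr> Obj = {X. medial_commutative_quandle X},
       Hom = (\<lambda>X Y. magma_hom X Y \<inter> extensional (carrier X)),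
       Ident = (\<lambda>X. \<lambda>x \<in> carrier X. x),
       Comp = (\<lambda>X Y Z g f. compose (carrier X) g f) \<rparr>"

definition module_hom :: "('r, 'c) ring_scheme \<Rightarrow> ('r, 'a) module \<Rightarrow> ('r, 'b) module \<Rightarrow> ('a \<Rightarrow> 'b) set"
  where
  "module_hom R M N = {T \<in> carrier M \<rightarrow> carrier N.
     (\<forall>x \<in> carrier M. \<forall>y \<in> carrier M. T (x \<oplus>\<^bsub>M\<^esub> y) = T x \<oplus>\<^bsub>N\<^esub> T y) \<and>
     (\<forall>r \<in> carrier R. \<forall>x \<in> carrier M. T (r \<odot>\<^bsub>M\<^esub> x) = r \<odot>\<^bsub>N\<^esub> T x)}"

text \<open>
  An object of \<open>AffMod R\<close> is \<open>Some M\<close> for an \<open>R\<close>-module \<open>M\<close>, or \<open>None\<close>, the empty set.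
  The fields \<open>mult\<close> and \<open>one\<close> that a module record inherits from rings are irrelevant: records
  differing only in these fields are isomorphic via the identity map. The library's modules
  require \<open>R\<close> to be commutative.
\<close>

fun underlying :: "('r, 'a) module option \<Rightarrow> 'a set" where
  "underlying None = {}"
| "underlying (Some M) = carrier M"

text \<open>\<open>\<lambda>_. undefined\<close> is the extensional representation of the unique map out of the empty set.\<close>

fun affine_maps ::
  "('r, 'c) ring_scheme \<Rightarrow> ('r, 'a) module option \<Rightarrow> ('r, 'b) module option \<Rightarrow> ('a \<Rightarrow> 'b) set"
  where
  "affine_maps R None Y = {\<lambda>_. undefined}"
| "affine_maps R (Some M) None = {}"
| "affine_maps R (Some M) (Some N) =
     {\<lambda>x \<in> carrier M. T x \<oplus>\<^bsub>N\<^esub> z | T z. T \<in> module_hom R M N \<and> z \<in> carrier N}"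

definition AffMod ::
  "('r, 'c) ring_scheme \<Rightarrow> (('r, 'a) module option, 'a \<Rightarrow> 'a) category" where
  "AffMod R =
     \<lparr> Obj = insert None (Some ` {M. module R M}),
       Hom = affine_maps R,
       Ident = (\<lambda>A. \<lambda>x \<in> underlying A. x),
       Comp = (\<lambda>A B C g f. compose (underlying A) g f) \<rparr>"

definition dyadic_ring :: "rat ring" where
  "dyadic_ring =
     \<lparr> carrier = {of_int a / 2 ^ n | (a :: int) (n :: nat). True},
       mult = (*), one = 1, zero = 0, add = (+) \<rparr>"

lemma cring_dyadic_ring: "cring dyadic_ring"
proof (rule cringI)
  let ?D = "carrier dyadic_ring"
  have inD: "x \<in> ?D" if "x = of_int a / 2 ^ n" for x a n
    using that by (auto simp: dyadic_ring_def)
  have add: "x + y \<in> ?D" if x: "x \<in> ?D" and y: "y \<in> ?D" for x y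
  proof -
    obtain a m b n where "x = of_int a / 2 ^ m" "y = of_int b / 2 ^ n"
      using x y by (auto simp: dyadic_ring_def)
    then have "x + y = of_int (a * 2 ^ n + b * 2 ^ m) / 2 ^ (m + n)"
      by (simp add: power_add add_frac_eq)
    then show ?thesis by (rule inD)
  qed
  have zero: "0 \<in> ?D" and one: "1 \<in> ?D"
    by (simp_all add: inD[of _ 0 0] inD[of _ 1 0])
  have neg: "- x \<in> ?D" if x: "x \<in> ?D" for x
  proof -
    obtain a m where "x = of_int a / 2 ^ m" using x by (auto simp: dyadic_ring_def)
    then have "- x = of_int (- a) / 2 ^ m" by simp
    then show ?thesis by (rule inD)
  qed
  have mult: "x * y \<in> ?D" if x: "x \<in> ?D" and y: "y \<in> ?D" for x y
  proof -
    obtain a m b n where "x = of_int a / 2 ^ m" "y = of_int b / 2 ^ n"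
      using x y by (auto simp: dyadic_ring_def)
    then have "x * y = of_int (a * b) / 2 ^ (m + n)"
      by (simp add: power_add)
    then show ?thesis by (rule inD)
  qed
  show "abelian_group dyadic_ring"
  proof (rule abelian_groupI)
    fix x assume "x \<in> ?D"
    then show "\<exists>y \<in> ?D. y \<oplus>\<^bsub>dyadic_ring\<^esub> x = \<zero>\<^bsub>dyadic_ring\<^esub>"
      using neg by (intro bexI[of _ "- x"]) (auto simp: dyadic_ring_def)
  qed (use add zero in \<open>auto simp: dyadic_ring_def\<close>)
  show "comm_monoid dyadic_ring"
    by (rule comm_monoidI) (use mult one in \<open>auto simp: dyadic_ring_def\<close>)
qed (auto simp: dyadic_ring_def algebra_simps)

fun midpoint_quandle :: "(rat, 'a) module option \<Rightarrow> 'a magma" where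
  "midpoint_quandle None = \<lparr> carrier = {}, qop = (\<lambda>x y. undefined) \<rparr>"
| "midpoint_quandle (Some M) =
     \<lparr> carrier = carrier M, qop = (\<lambda>x y. (1 / 2) \<odot>\<^bsub>M\<^esub> (x \<oplus>\<^bsub>M\<^esub> y)) \<rparr>"

definition mid :: "((rat, 'a) module option, 'a \<Rightarrow> 'a, 'a magma, 'a \<Rightarrow> 'a) cfunctor" where
  "mid = \<lparr> omap = midpoint_quandle, amap = (\<lambda>A B f. f) \<rparr>"

end

theory Submission
  imports Defs
begin

text \<open>
  In a module over the dyadic rationals \<open>x + y\<close> is the double of the midpoint of \<open>x\<close> and \<open>y\<close>, and
  half of \<open>x\<close> is the midpoint of \<open>x\<close> and zero. So once a zero is chosen, the midpoint operation
  determines the whole module structure, and forgetting the choice leaves exactly affine geometry.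
  The equivalence is this observation, read twice.

  On morphisms (lemma \<open>affine_maps_eq_midpoint_homs\<close>): a midpoint-preserving map, translated so that
  it preserves zero, preserves halves, hence sums, hence multiplication by every dyadic scalar. Thus
  the affine maps between two modules are precisely the homomorphisms of their midpoint quandles.

  On objects (lemma \<open>mc_quandle_is_midpoint_quandle\<close>): in a nonempty medial commutative quandle
  fix an element \<open>e\<close>, to become the zero. Right multiplication by \<open>e\<close> is bijective and is going to be
  halving, so \<open>x + y\<close> has to be the element whose product with \<open>e\<close> is \<open>x \<star> y\<close>. Mediality makes this
  associative, bijectivity of the other right multiplications gives negatives, and idempotence makes
  doubling inverse to halving. An abelian group in which doubling is bijective carries a dyadic
  scalar multiplication: \<open>(a / 2\<^sup>n) x\<close> is the unique solution \<open>y\<close> of \<open>2\<^sup>n y = a x\<close>.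

  Since the functor is the identity on underlying maps and the module built from a quandle has the
  same elements, the inverse functor also acts identically on maps, and both natural isomorphisms
  are given by identity maps.
\<close>

section \<open>Dyadic rationals\<close>

lemma dyadic_ring_simps [simp]:
  "add dyadic_ring = (+)" "mult dyadic_ring = (*)" "one dyadic_ring = 1" "zero dyadic_ring = 0"
  by (simp_all add: dyadic_ring_def)

lemma carrier_dyadic_ring: "carrier dyadic_ring = {of_int a / 2 ^ n | a n. True}"
  by (simp add: dyadic_ring_def)

lemma dyadic_fraction_in_carrier [simp]: "of_int a / 2 ^ n \<in> carrier dyadic_ring"
  by (auto simp: carrier_dyadic_ring)

lemma dyadicE:
  assumes "r \<in> carrier dyadic_ring"
  obtains a n where "r = of_int a / 2 ^ n"
  using assms by (auto simp: carrier_dyadic_ring)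

lemma int_in_dyadic_ring [simp]: "of_int a \<in> carrier dyadic_ring"
  using dyadic_fraction_in_carrier[of a 0] by simp

lemma one_in_dyadic_ring [simp]: "1 \<in> carrier dyadic_ring"
  using int_in_dyadic_ring[of 1] by simp

lemma half_in_dyadic_ring [simp]: "1 / 2 \<in> carrier dyadic_ring"
  using dyadic_fraction_in_carrier[of 1 1] by simp

lemma dyadic_induct [consumes 1, case_names one add minus half]:
  assumes r: "r \<in> carrier dyadic_ring"
    and one: "P 1"
    and add: "\<And>r s. \<lbrakk> r \<in> carrier dyadic_ring; s \<in> carrier dyadic_ring; P r; P s \<rbrakk> \<Longrightarrow> P (r + s)"
    and minus: "\<And>r. \<lbrakk> r \<in> carrier dyadic_ring; P r \<rbrakk> \<Longrightarrow> P (- r)"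
    and half: "\<And>r. \<lbrakk> r \<in> carrier dyadic_ring; P r \<rbrakk> \<Longrightarrow> P (1 / 2 * r)"
  shows "P r"
proof -
  have neg_one: "P (- 1)"
    using minus[of 1] one by simp
  have zero: "P 0"
    using add[of 1 "- 1"] one neg_one int_in_dyadic_ring[of "- 1"] by simp
  have int: "P (of_int a)" for a
  proof (induction a rule: int_induct[of _ 0])
    case base
    then show ?case using zero by simp
  next
    case (step1 i)
    then show ?case using add[of "of_int i" 1] one by simp
  next
    case (step2 i)
    then show ?case using add[of "of_int i" "- 1"] neg_one int_in_dyadic_ring[of "- 1"] by simp
  qed
  have "P (of_int a / 2 ^ n)" for a n
  proof (induction n)
    case 0
    then show ?case using int by simp
  next
    case (Suc n)
    then show ?case using half[of "of_int a / 2 ^ n"] by simp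
  qed
  then show ?thesis using r by (metis dyadicE)
qed

section \<open>The midpoint quandle of a module\<close>

locale dyadic_module = module dyadic_ring M for M :: "(rat, 'a) module" (structure)
begin

definition midpoint :: "'a \<Rightarrow> 'a \<Rightarrow> 'a" where
  "midpoint x y = (1 / 2) \<odot> (x \<oplus> y)"

lemma half_closed [simp, intro]: "x \<in> carrier M \<Longrightarrow> (1 / 2) \<odot> x \<in> carrier M"
  by (rule smult_closed) simp_all

lemma half_add_half [simp]:
  assumes "x \<in> carrier M"
  shows "(1 / 2) \<odot> x \<oplus> (1 / 2) \<odot> x = x"
  using smult_l_distr[of "1/2" "1/2" x] smult_one[OF assms] assms by simp

lemma half_distrib:
  "\<lbrakk> x \<in> carrier M; y \<in> carrier M \<rbrakk> \<Longrightarrow> (1 / 2) \<odot> (x \<oplus> y) = (1 / 2) \<odot> x \<oplus> (1 / 2) \<odot> y"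
  by (rule smult_r_distr) simp_all

lemma midpoint_closed [simp, intro]:
  "\<lbrakk> x \<in> carrier M; y \<in> carrier M \<rbrakk> \<Longrightarrow> midpoint x y \<in> carrier M"
  by (simp add: midpoint_def)

lemma midpoint_idem: "x \<in> carrier M \<Longrightarrow> midpoint x x = x"
  by (simp add: midpoint_def half_distrib)

lemma midpoint_commute: "\<lbrakk> x \<in> carrier M; y \<in> carrier M \<rbrakk> \<Longrightarrow> midpoint x y = midpoint y x"
  by (simp add: midpoint_def M.a_comm)

lemma midpoint_medial:
  assumes "a \<in> carrier M" "b \<in> carrier M" "c \<in> carrier M" "d \<in> carrier M"
  shows "midpoint (midpoint a b) (midpoint c d) = midpoint (midpoint a c) (midpoint b d)"
  using assms by (simp add: midpoint_def half_distrib M.a_ac)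

lemma midpoint_add_midpoint:
  "\<lbrakk> x \<in> carrier M; y \<in> carrier M \<rbrakk> \<Longrightarrow> midpoint x y \<oplus> midpoint x y = x \<oplus> y"
  by (simp add: midpoint_def)

lemma bij_betw_midpoint:
  assumes x: "x \<in> carrier M"
  shows "bij_betw (\<lambda>y. midpoint y x) (carrier M) (carrier M)"
proof (rule bij_betw_imageI)
  show "inj_on (\<lambda>y. midpoint y x) (carrier M)"
  proof (rule inj_onI)
    fix y z assume yz: "y \<in> carrier M" "z \<in> carrier M" and eq: "midpoint y x = midpoint z x"
    then have "y \<oplus> x = z \<oplus> x"
      using x midpoint_add_midpoint by metis
    then show "y = z" using yz x by simp
  qed
  show "(\<lambda>y. midpoint y x) ` carrier M = carrier M"
  proof
    show "carrier M \<subseteq> (\<lambda>y. midpoint y x) ` carrier M"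
    proof
      fix z assume z: "z \<in> carrier M"
      \<comment> \<open>The reflection of \<open>x\<close> in \<open>z\<close>.\<close>
      let ?y = "(z \<oplus> z) \<oplus> \<ominus> x"
      have "?y \<oplus> x = z \<oplus> z"
        using x z by (simp add: M.a_assoc M.l_neg)
      then have "midpoint ?y x = z"
        using midpoint_idem[OF z] by (simp add: midpoint_def)
      then show "z \<in> (\<lambda>y. midpoint y x) ` carrier M"
        using x z by (intro image_eqI[of _ _ ?y]) auto
    qed
  qed (use x in auto)
qed

lemma midpoint_quandle_ops [simp]:
  "carrier (midpoint_quandle (Some M)) = carrier M"
  "qop (midpoint_quandle (Some M)) = midpoint"
  by (simp_all add: midpoint_def fun_eq_iff)

lemma medial_commutative_midpoint_quandle:
  "medial_commutative_quandle (midpoint_quandle (Some M))"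
proof (unfold_locales, unfold midpoint_quandle_ops)
  fix x assume x: "x \<in> carrier M"
  \<comment> \<open>Right self-distributivity is mediality with one idempotent factor.\<close>
  have "midpoint (midpoint y z) x = midpoint (midpoint y x) (midpoint z x)"
    if "y \<in> carrier M" "z \<in> carrier M" for y z
    using midpoint_medial[of y z x x] midpoint_idem[OF x] that x by simp
  then show "(\<lambda>y. midpoint y x) \<in> magma_aut (midpoint_quandle (Some M))"
    unfolding magma_aut_def magma_hom_def midpoint_quandle_ops
    using x bij_betw_midpoint[OF x] by auto
qed (auto simp: midpoint_idem midpoint_commute intro: midpoint_medial)

end

section \<open>Midpoint-preserving maps are affine\<close>

text \<open>
  The scalars that commute with an additive map form a subgroup containing 1, which is closed under
  halving because halves are unique in a module over the dyadic rationals.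
\<close>

lemma additive_imp_dyadic_module_hom:
  assumes M: "dyadic_module M" and N: "dyadic_module N"
    and T: "T \<in> carrier M \<rightarrow> carrier N"
    and add: "\<And>x y. \<lbrakk> x \<in> carrier M; y \<in> carrier M \<rbrakk> \<Longrightarrow> T (x \<oplus>\<^bsub>M\<^esub> y) = T x \<oplus>\<^bsub>N\<^esub> T y"
  shows "T \<in> module_hom dyadic_ring M N"
proof -
  interpret M: dyadic_module M by (rule M)
  interpret N: dyadic_module N by (rule N)
  have T_closed [simp]: "T x \<in> carrier N" if "x \<in> carrier M" for x
    using T that by auto
  have T_half: "T ((1 / 2) \<odot>\<^bsub>M\<^esub> x) = (1 / 2) \<odot>\<^bsub>N\<^esub> T x" if x: "x \<in> carrier M" for x
  proof -
    let ?h = "T ((1 / 2) \<odot>\<^bsub>M\<^esub> x)"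
    have "?h = (1 / 2) \<odot>\<^bsub>N\<^esub> (?h \<oplus>\<^bsub>N\<^esub> ?h)"
      using x by (simp add: N.half_distrib)
    also have "?h \<oplus>\<^bsub>N\<^esub> ?h = T x"
      using x add[of "(1 / 2) \<odot>\<^bsub>M\<^esub> x" "(1 / 2) \<odot>\<^bsub>M\<^esub> x"] by simp
    finally show ?thesis .
  qed
  have T_zero: "T \<zero>\<^bsub>M\<^esub> = \<zero>\<^bsub>N\<^esub>"
    using add[of "\<zero>\<^bsub>M\<^esub>" "\<zero>\<^bsub>M\<^esub>"] by (metis M.M.zero_closed M.M.l_zero N.M.add.r_cancel_one' T_closed)
  have T_minus: "T (\<ominus>\<^bsub>M\<^esub> x) = \<ominus>\<^bsub>N\<^esub> T x" if x: "x \<in> carrier M" for x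
    using add[of "\<ominus>\<^bsub>M\<^esub> x" x] x T_zero by (simp add: M.M.l_neg N.M.minus_equality)
  have neg_smult: "(- r) \<odot>\<^bsub>K\<^esub> x = \<ominus>\<^bsub>K\<^esub> (r \<odot>\<^bsub>K\<^esub> x)"
    if K: "dyadic_module K" and r: "r \<in> carrier dyadic_ring" and x: "x \<in> carrier K"
    for K :: "(rat, 'c) module" and r x
  proof -
    interpret K: dyadic_module K by (rule K)
    obtain a n where "r = of_int a / 2 ^ n" using r by (rule dyadicE)
    then have "- r = of_int (- a) / 2 ^ n" by simp
    then have neg: "- r \<in> carrier dyadic_ring" by (simp only: dyadic_fraction_in_carrier)
    have "(- r) \<odot>\<^bsub>K\<^esub> x \<oplus>\<^bsub>K\<^esub> r \<odot>\<^bsub>K\<^esub> x = \<zero>\<^bsub>K\<^esub>"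
      using K.smult_l_distr[OF neg r x] K.smult_l_null[OF x] by simp
    then show ?thesis using neg r x by (simp add: K.M.minus_equality)
  qed
  have "\<forall>x \<in> carrier M. T (r \<odot>\<^bsub>M\<^esub> x) = r \<odot>\<^bsub>N\<^esub> T x" if "r \<in> carrier dyadic_ring" for r
    using that
  proof (induction r rule: dyadic_induct)
    case one
    then show ?case using M.smult_one N.smult_one by simp
  next
    case (add r s)
    then show ?case using M.smult_l_distr[of r s] N.smult_l_distr[of r s] assms(4) by simp
  next
    case (minus r)
    then show ?case using neg_smult[OF M] neg_smult[OF N] T_minus by simp
  next
    case (half r)
    then show ?case
      using M.smult_assoc1[of "1 / 2" r] N.smult_assoc1[of "1 / 2" r] T_half by simp
  qed
  then show ?thesis using T add by (simp add: module_hom_def)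
qed

text \<open>
  Subtracting the value at zero turns a midpoint-preserving map into one that preserves midpoints
  and zero, hence halves; it then preserves sums, a sum being the double of a midpoint.
\<close>

lemma midpoint_hom_imp_affine:
  assumes M: "dyadic_module M" and N: "dyadic_module N"
    and f: "f \<in> magma_hom (midpoint_quandle (Some M)) (midpoint_quandle (Some N))"
  shows "\<exists>T \<in> module_hom dyadic_ring M N. \<exists>z \<in> carrier N. \<forall>x \<in> carrier M. f x = T x \<oplus>\<^bsub>N\<^esub> z"
proof -
  interpret M: dyadic_module M by (rule M)
  interpret N: dyadic_module N by (rule N)
  have f_closed [simp]: "f x \<in> carrier N" if "x \<in> carrier M" for x
    using f that by (auto simp: magma_hom_def)
  have f_mid: "f (M.midpoint x y) = N.midpoint (f x) (f y)"
    if "x \<in> carrier M" "y \<in> carrier M" for x y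
    using f that by (simp add: magma_hom_def M.midpoint_def N.midpoint_def)
  define z where "z = f \<zero>\<^bsub>M\<^esub>"
  define T where "T = (\<lambda>x. f x \<oplus>\<^bsub>N\<^esub> \<ominus>\<^bsub>N\<^esub> z)"
  have z [simp]: "z \<in> carrier N" by (simp add: z_def)
  have f_T: "f x = T x \<oplus>\<^bsub>N\<^esub> z" if "x \<in> carrier M" for x
    using that by (simp add: T_def N.M.a_assoc N.M.l_neg)
  have T_closed [simp]: "T x \<in> carrier N" if "x \<in> carrier M" for x
    using that by (simp add: T_def)
  have T_zero: "T \<zero>\<^bsub>M\<^esub> = \<zero>\<^bsub>N\<^esub>"
    by (simp add: T_def flip: z_def) (simp add: N.M.r_neg)
  have T_mid: "T (M.midpoint x y) = N.midpoint (T x) (T y)"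
    if x: "x \<in> carrier M" and y: "y \<in> carrier M" for x y
  proof -
    have "T (M.midpoint x y) \<oplus>\<^bsub>N\<^esub> z = N.midpoint (T x \<oplus>\<^bsub>N\<^esub> z) (T y \<oplus>\<^bsub>N\<^esub> z)"
      using x y f_mid[OF x y] by (simp flip: f_T)
    also have "\<dots> = N.midpoint (T x) (T y) \<oplus>\<^bsub>N\<^esub> N.midpoint z z"
      using x y by (simp add: N.midpoint_def N.half_distrib N.M.a_ac del: N.half_add_half)
    finally show ?thesis using x y by (simp add: N.midpoint_idem)
  qed
  have T_half: "T ((1 / 2) \<odot>\<^bsub>M\<^esub> x) = (1 / 2) \<odot>\<^bsub>N\<^esub> T x" if x: "x \<in> carrier M" for x
    using T_mid[of x "\<zero>\<^bsub>M\<^esub>"] x by (simp add: M.midpoint_def N.midpoint_def T_zero)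
  have T_add: "T (x \<oplus>\<^bsub>M\<^esub> y) = T x \<oplus>\<^bsub>N\<^esub> T y" if x: "x \<in> carrier M" and y: "y \<in> carrier M" for x y
  proof -
    have "(1 / 2) \<odot>\<^bsub>N\<^esub> T (x \<oplus>\<^bsub>M\<^esub> y) = (1 / 2) \<odot>\<^bsub>N\<^esub> (T x \<oplus>\<^bsub>N\<^esub> T y)"
      using T_mid[OF x y] T_half[of "x \<oplus>\<^bsub>M\<^esub> y"] x y by (simp add: M.midpoint_def N.midpoint_def)
    then show ?thesis
      using N.half_add_half x y by (metis M.M.a_closed N.M.a_closed T_closed)
  qed
  have "T \<in> module_hom dyadic_ring M N"
    using M N T_add by (intro additive_imp_dyadic_module_hom) auto
  then show ?thesis using f_T z by blast
qed

lemma affine_imp_midpoint_hom: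
  assumes M: "dyadic_module M" and N: "dyadic_module N"
    and T: "T \<in> module_hom dyadic_ring M N" and z: "z \<in> carrier N"
  shows "(\<lambda>x \<in> carrier M. T x \<oplus>\<^bsub>N\<^esub> z) \<in> magma_hom (midpoint_quandle (Some M)) (midpoint_quandle (Some N))"
proof -
  interpret M: dyadic_module M by (rule M)
  interpret N: dyadic_module N by (rule N)
  have T_closed [simp]: "T x \<in> carrier N" if "x \<in> carrier M" for x
    using T that by (auto simp: module_hom_def)
  have "T (M.midpoint x y) \<oplus>\<^bsub>N\<^esub> z = N.midpoint (T x \<oplus>\<^bsub>N\<^esub> z) (T y \<oplus>\<^bsub>N\<^esub> z)"
    if x: "x \<in> carrier M" and y: "y \<in> carrier M" for x y
  proof -
    have "T (M.midpoint x y) = N.midpoint (T x) (T y)"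
      using T x y half_in_dyadic_ring by (simp add: module_hom_def M.midpoint_def N.midpoint_def)
    then have "T (M.midpoint x y) \<oplus>\<^bsub>N\<^esub> z = N.midpoint (T x) (T y) \<oplus>\<^bsub>N\<^esub> N.midpoint z z"
      using z by (simp add: N.midpoint_idem)
    also have "\<dots> = N.midpoint (T x \<oplus>\<^bsub>N\<^esub> z) (T y \<oplus>\<^bsub>N\<^esub> z)"
      using x y z by (simp add: N.midpoint_def N.half_distrib N.M.a_ac del: N.half_add_half)
    finally show ?thesis .
  qed
  then show ?thesis
    unfolding magma_hom_def M.midpoint_quandle_ops N.midpoint_quandle_ops using z by auto
qed

lemma carrier_midpoint_quandle [simp]: "carrier (midpoint_quandle A) = underlying A"
  by (cases A) simp_all

lemma AffMod_obj_cases: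
  assumes "A \<in> Obj (AffMod dyadic_ring)"
  obtains "A = None" | M where "A = Some M" "dyadic_module M"
  using assms by (auto simp: AffMod_def dyadic_module_def)

lemma affine_maps_eq_midpoint_homs:
  assumes "A \<in> Obj (AffMod dyadic_ring)" "B \<in> Obj (AffMod dyadic_ring)"
  shows "affine_maps dyadic_ring A B =
    magma_hom (midpoint_quandle A) (midpoint_quandle B) \<inter> extensional (underlying A)"
  using assms(1)
proof (cases A rule: AffMod_obj_cases)
  case 1
  then show ?thesis by (auto simp: magma_hom_def)
next
  case (2 M)
  interpret M: dyadic_module M by (rule 2)
  show ?thesis
    using assms(2)
  proof (cases B rule: AffMod_obj_cases)
    case 1
    then show ?thesis
      using 2 M.M.zero_closed by (auto simp: magma_hom_def simp del: M.M.zero_closed)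
  next
    case N: (2 N)
    show ?thesis
    proof (intro equalityI subsetI)
      fix f assume "f \<in> affine_maps dyadic_ring A B"
      then show "f \<in> magma_hom (midpoint_quandle A) (midpoint_quandle B) \<inter> extensional (underlying A)"
        using 2 N affine_imp_midpoint_hom[of M N] by (auto simp del: midpoint_quandle.simps)
    next
      fix f
      assume f: "f \<in> magma_hom (midpoint_quandle A) (midpoint_quandle B) \<inter> extensional (underlying A)"
      then obtain T z where Tz: "T \<in> module_hom dyadic_ring M N" "z \<in> carrier N"
        and eq: "\<And>x. x \<in> carrier M \<Longrightarrow> f x = T x \<oplus>\<^bsub>N\<^esub> z"
        using 2 N midpoint_hom_imp_affine[of M N f] by (auto simp del: midpoint_quandle.simps)
      have "f = (\<lambda>x \<in> carrier M. T x \<oplus>\<^bsub>N\<^esub> z)"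
        using f 2 by (intro extensionalityI[of _ "carrier M"]) (auto simp: eq)
      then show "f \<in> affine_maps dyadic_ring A B" using 2 N Tz by auto
    qed
  qed
qed

section \<open>Uniquely 2-divisible abelian groups are dyadic modules\<close>

locale uniquely_two_divisible_group = abelian_group G for G (structure) +
  assumes bij_double: "bij_betw (\<lambda>x. x \<oplus> x) (carrier G) (carrier G)"
begin

lemma int_scale_scale: "x \<in> carrier G \<Longrightarrow> [k] \<cdot> ([l] \<cdot> x) = [(k * l :: int)] \<cdot> x"
  using add.int_pow_pow[of x k l] by (simp add: mult.commute)

lemma int_scale_power2_Suc:
  "x \<in> carrier G \<Longrightarrow> [(2 ^ Suc n :: int)] \<cdot> x = [(2 ^ n :: int)] \<cdot> (x \<oplus> x)"
  using add.int_pow_mult[of x "2 ^ n" "2 ^ n"] by (simp add: add.int_pow_distrib)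

lemma bij_scale_power2: "bij_betw (\<lambda>y. [(2 ^ n :: int)] \<cdot> y) (carrier G) (carrier G)"
proof (induction n)
  case 0
  show ?case by (rule bij_betwI[where g = "\<lambda>y. y"]) simp_all
next
  case (Suc n)
  have "bij_betw ((\<lambda>y. [(2 ^ n :: int)] \<cdot> y) \<circ> (\<lambda>x. x \<oplus> x)) (carrier G) (carrier G)"
    by (rule bij_betw_trans[OF bij_double Suc])
  then show ?case
    by (rule iffD1[OF bij_betw_cong, rotated]) (simp only: o_apply int_scale_power2_Suc)
qed

lemma scale_power2_injective:
  "\<lbrakk> [(2 ^ n :: int)] \<cdot> y = [(2 ^ n :: int)] \<cdot> z; y \<in> carrier G; z \<in> carrier G \<rbrakk> \<Longrightarrow> y = z"
  by (rule inj_onD[OF bij_betw_imp_inj_on[OF bij_scale_power2]])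

lemma divide_power2E:
  assumes "x \<in> carrier G"
  obtains y where "y \<in> carrier G" "[(2 ^ n :: int)] \<cdot> y = x"
proof -
  have "x \<in> (\<lambda>y. [(2 ^ n :: int)] \<cdot> y) ` carrier G"
    using assms by (simp only: bij_betw_imp_surj_on[OF bij_scale_power2])
  then show ?thesis using that by (elim imageE) (rule that, simp_all only:)
qed

text \<open>
  Ranging over all representations of the scalar, reduced or not, avoids normal forms in the
  verification of the module laws, where sums and products of fractions come out unreduced.
\<close>

definition dyadic_smult :: "rat \<Rightarrow> 'a \<Rightarrow> 'a" where
  "dyadic_smult r x =
     (THE y. y \<in> carrier G \<and> (\<exists>a n. r = of_int a / 2 ^ n \<and> [(2 ^ n :: int)] \<cdot> y = [(a :: int)] \<cdot> x))"

text \<open>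
  Cross-multiplication: if \<open>a / 2\<^sup>n = b / 2\<^sup>m\<close>, then multiplying \<open>2\<^sup>n y = a x\<close> by \<open>2\<^sup>m\<close> and
  \<open>2\<^sup>m z = b x\<close> by \<open>2\<^sup>n\<close> gives \<open>2\<^sup>n\<^sup>+\<^sup>m y = 2\<^sup>n\<^sup>+\<^sup>m z\<close>, and division by powers of 2 is unique. The
  module laws below all follow by exhibiting a solution and appealing to this uniqueness.
\<close>

lemma dyadic_smult_unique:
  assumes x: "x \<in> carrier G" and y: "y \<in> carrier G"
    and r: "r = of_int a / 2 ^ n" and eq: "[(2 ^ n :: int)] \<cdot> y = [a] \<cdot> x"
  shows "dyadic_smult r x = y"
  unfolding dyadic_smult_def
proof (rule the_equality)
  show "y \<in> carrier G \<and> (\<exists>a n. r = of_int a / 2 ^ n \<and> [(2 ^ n :: int)] \<cdot> y = [(a :: int)] \<cdot> x)"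
    using y r eq by blast
next
  fix z assume "z \<in> carrier G \<and> (\<exists>a n. r = of_int a / 2 ^ n \<and> [(2 ^ n :: int)] \<cdot> z = [(a :: int)] \<cdot> x)"
  then obtain b m where z: "z \<in> carrier G" and r': "r = of_int b / 2 ^ m"
    and eq': "[(2 ^ m :: int)] \<cdot> z = [b] \<cdot> x" by blast
  have "(of_int (a * 2 ^ m) :: rat) = of_int (b * 2 ^ n)"
    using r r' by (simp add: field_simps)
  then have ab: "a * 2 ^ m = b * 2 ^ n" by (simp only: of_int_eq_iff)
  have "[(2 ^ (n + m) :: int)] \<cdot> y = [(a * 2 ^ m)] \<cdot> x"
    using int_scale_scale[OF y, of "2 ^ m" "2 ^ n"] int_scale_scale[OF x, of "2 ^ m" a] eq
    by (simp add: power_add mult.commute)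
  also have "\<dots> = [(b * 2 ^ n)] \<cdot> x"
    by (simp only: ab)
  also have "\<dots> = [(2 ^ (n + m) :: int)] \<cdot> z"
    using int_scale_scale[OF z, of "2 ^ n" "2 ^ m"] int_scale_scale[OF x, of "2 ^ n" b] eq'
    by (simp add: power_add mult.commute)
  finally show "z = y"
    by (rule scale_power2_injective[OF _ y z, symmetric])
qed

lemma dyadic_smult_fraction:
  assumes x: "x \<in> carrier G"
  shows "dyadic_smult (of_int a / 2 ^ n) x \<in> carrier G"
    and "[(2 ^ n :: int)] \<cdot> dyadic_smult (of_int a / 2 ^ n) x = [a] \<cdot> x"
proof -
  obtain y where y: "y \<in> carrier G" "[(2 ^ n :: int)] \<cdot> y = [a] \<cdot> x"
    by (rule divide_power2E[OF add.int_pow_closed[OF x]])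
  then have "dyadic_smult (of_int a / 2 ^ n) x = y"
    by (intro dyadic_smult_unique[OF x _ refl])
  with y show "dyadic_smult (of_int a / 2 ^ n) x \<in> carrier G"
    and "[(2 ^ n :: int)] \<cdot> dyadic_smult (of_int a / 2 ^ n) x = [a] \<cdot> x"
    by simp_all
qed

definition dyadic_module_of :: "(rat, 'a) module" where
  "dyadic_module_of =
     \<lparr> carrier = carrier G, mult = undefined, one = undefined,
       zero = \<zero>, add = (\<oplus>), smult = dyadic_smult \<rparr>"

lemma dyadic_module_of_simps [simp]:
  "carrier dyadic_module_of = carrier G" "zero dyadic_module_of = \<zero>"
  "add dyadic_module_of = (\<oplus>)" "smult dyadic_module_of = dyadic_smult"
  by (simp_all add: dyadic_module_of_def)

lemma abelian_group_dyadic_module_of: "abelian_group dyadic_module_of"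
proof (rule abelian_groupI, unfold dyadic_module_of_simps)
  fix x assume "x \<in> carrier G"
  then show "\<exists>y \<in> carrier G. y \<oplus> x = \<zero>"
    by (intro bexI[of _ "\<ominus> x"]) (simp_all add: l_neg)
qed (simp_all add: a_assoc, simp add: a_comm)

lemma module_dyadic_module_of: "module dyadic_ring dyadic_module_of"
proof (rule moduleI[OF cring_dyadic_ring abelian_group_dyadic_module_of],
    unfold dyadic_module_of_simps dyadic_ring_simps)
  fix r x assume r: "r \<in> carrier dyadic_ring" and x: "x \<in> carrier G"
  obtain a m where ra: "r = of_int a / 2 ^ m" using r by (rule dyadicE)
  let ?u = "dyadic_smult r x"
  show u: "?u \<in> carrier G" using dyadic_smult_fraction[OF x] ra by simp
  have ueq: "[(2 ^ m :: int)] \<cdot> ?u = [a] \<cdot> x" using dyadic_smult_fraction[OF x] ra by simp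
  {
    fix y assume y: "y \<in> carrier G"
    show "dyadic_smult r (x \<oplus> y) = ?u \<oplus> dyadic_smult r y"
    proof (rule dyadic_smult_unique[OF _ _ ra])
      show "[(2 ^ m :: int)] \<cdot> (?u \<oplus> dyadic_smult r y) = [a] \<cdot> (x \<oplus> y)"
        using dyadic_smult_fraction[OF y] x y u ra ueq by (simp add: add.int_pow_distrib)
    qed (use x y u dyadic_smult_fraction[OF y] ra in auto)
  }
  fix s assume s: "s \<in> carrier dyadic_ring"
  obtain b n where sb: "s = of_int b / 2 ^ n" using s by (rule dyadicE)
  let ?v = "dyadic_smult s x"
  have v: "?v \<in> carrier G" and veq: "[(2 ^ n :: int)] \<cdot> ?v = [b] \<cdot> x"
    using dyadic_smult_fraction[OF x] sb by simp_all
  show "dyadic_smult (r + s) x = ?u \<oplus> ?v"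
  proof (rule dyadic_smult_unique[OF x, where a = "a * 2 ^ n + b * 2 ^ m" and n = "m + n"])
    have "[(2 ^ (m + n) :: int)] \<cdot> ?u = [(a * 2 ^ n)] \<cdot> x"
      using int_scale_scale[OF u, of "2 ^ n" "2 ^ m"] int_scale_scale[OF x, of "2 ^ n" a] ueq
      by (simp add: power_add mult.commute)
    moreover have "[(2 ^ (m + n) :: int)] \<cdot> ?v = [(b * 2 ^ m)] \<cdot> x"
      using int_scale_scale[OF v, of "2 ^ m" "2 ^ n"] int_scale_scale[OF x, of "2 ^ m" b] veq
      by (simp add: power_add mult.commute)
    ultimately show "[(2 ^ (m + n) :: int)] \<cdot> (?u \<oplus> ?v) = [(a * 2 ^ n + b * 2 ^ m)] \<cdot> x"
      using x u v by (simp add: add.int_pow_distrib add.int_pow_mult)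
    show "r + s = of_int (a * 2 ^ n + b * 2 ^ m) / 2 ^ (m + n)"
      unfolding ra sb by (simp add: power_add add_frac_eq)
  qed (use u v in simp)
  show "dyadic_smult (r * s) x = dyadic_smult r ?v"
  proof (rule dyadic_smult_unique[OF x, where a = "a * b" and n = "m + n"])
    let ?w = "dyadic_smult r ?v"
    show w: "?w \<in> carrier G" using dyadic_smult_fraction[OF v] ra by simp
    have weq: "[(2 ^ m :: int)] \<cdot> ?w = [a] \<cdot> ?v" using dyadic_smult_fraction[OF v] ra by simp
    have "[(2 ^ (m + n) :: int)] \<cdot> ?w = [(2 ^ n :: int)] \<cdot> ([a] \<cdot> ?v)"
      using int_scale_scale[OF w, of "2 ^ n" "2 ^ m"] weq by (simp add: power_add mult.commute)
    also have "\<dots> = [a] \<cdot> ([(2 ^ n :: int)] \<cdot> ?v)"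
      by (simp only: int_scale_scale[OF v] mult.commute)
    also have "\<dots> = [(a * b)] \<cdot> x"
      by (simp only: veq int_scale_scale[OF x])
    finally show "[(2 ^ (m + n) :: int)] \<cdot> ?w = [(a * b)] \<cdot> x" .
  qed (use ra sb in \<open>simp add: power_add\<close>)
next
  fix x assume x: "x \<in> carrier G"
  then show "dyadic_smult 1 x = x"
    by (intro dyadic_smult_unique[where a = 1 and n = 0]) simp_all
qed

lemma dyadic_smult_half:
  assumes "x \<in> carrier G" "y \<in> carrier G" "y \<oplus> y = x"
  shows "dyadic_smult (1 / 2) x = y"
  by (rule dyadic_smult_unique[where a = 1 and n = 1])
    (use assms int_scale_power2_Suc[of y 0] in simp_all)

end

section \<open>The module of a pointed medial commutative quandle\<close>

locale pointed_mc_quandle = medial_commutative_quandle X for X :: "'a magma" (structure) +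
  fixes e
  assumes base_point [simp]: "e \<in> carrier X"
begin

definition halve :: "'a \<Rightarrow> 'a" where
  "halve y = y \<star> e"

text \<open>The midpoint of \<open>x\<close> and \<open>y\<close> must become half of their sum.\<close>

definition plus :: "'a \<Rightarrow> 'a \<Rightarrow> 'a" where
  "plus x y = inv_into (carrier X) halve (x \<star> y)"

lemma bij_halve: "bij_betw halve (carrier X) (carrier X)"
  using right_mult_aut[OF base_point] by (simp add: magma_aut_def halve_def[abs_def])

lemma halve_closed [simp]: "x \<in> carrier X \<Longrightarrow> halve x \<in> carrier X"
  using qop_closed by (simp add: halve_def)

lemma halve_injective: "\<lbrakk> halve x = halve y; x \<in> carrier X; y \<in> carrier X \<rbrakk> \<Longrightarrow> x = y"
  using bij_halve by (auto simp: bij_betw_def inj_on_def)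

lemma halve_qop: "\<lbrakk> x \<in> carrier X; y \<in> carrier X \<rbrakk> \<Longrightarrow> halve (x \<star> y) = halve x \<star> halve y"
  using right_mult_aut[OF base_point] by (auto simp: magma_aut_def magma_hom_def halve_def)

lemma halve_base: "halve e = e"
  by (simp add: halve_def qop_idem)

lemma plus_closed [simp]: "\<lbrakk> x \<in> carrier X; y \<in> carrier X \<rbrakk> \<Longrightarrow> plus x y \<in> carrier X"
  unfolding plus_def using bij_halve qop_closed by (metis bij_betw_def inv_into_into)

lemma halve_plus: "\<lbrakk> x \<in> carrier X; y \<in> carrier X \<rbrakk> \<Longrightarrow> halve (plus x y) = x \<star> y"
  unfolding plus_def using bij_halve qop_closed by (metis bij_betw_def f_inv_into_f)

lemma plus_commute: "\<lbrakk> x \<in> carrier X; y \<in> carrier X \<rbrakk> \<Longrightarrow> plus x y = plus y x"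
  by (simp add: plus_def commutative)

lemma plus_halve_halve: "x \<in> carrier X \<Longrightarrow> plus (halve x) (halve x) = x"
  by (rule halve_injective) (simp_all add: halve_plus qop_idem)

text \<open>
  After halving twice, the sum of three elements is a product of four, with the base point as
  the fourth factor, and mediality exchanges the middle two.
\<close>

lemma plus_right_commute:
  assumes "x \<in> carrier X" "y \<in> carrier X" "z \<in> carrier X"
  shows "plus (plus x y) z = plus (plus x z) y"
proof -
  have "halve (halve (plus (plus u v) w)) = (u \<star> v) \<star> (w \<star> e)"
    if "u \<in> carrier X" "v \<in> carrier X" "w \<in> carrier X" for u v w
    using that by (simp add: halve_plus halve_qop) (simp add: halve_def)
  then have "halve (halve (plus (plus x y) z)) = halve (halve (plus (plus x z) y))"
    using assms medial[of x y z e] by simp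
  then have "halve (plus (plus x y) z) = halve (plus (plus x z) y)"
    by (rule halve_injective) (use assms in simp_all)
  then show ?thesis
    by (rule halve_injective) (use assms in simp_all)
qed

lemma plus_assoc:
  assumes "x \<in> carrier X" "y \<in> carrier X" "z \<in> carrier X"
  shows "plus (plus x y) z = plus x (plus y z)"
  using assms plus_right_commute[of y x z]
  by (simp only: plus_commute[of x y] plus_commute[of x "plus y z"] plus_closed)

text \<open>A negative of \<open>x\<close> is an element whose midpoint with \<open>x\<close> is the base point.\<close>

lemma ex_negative:
  assumes x: "x \<in> carrier X"
  shows "\<exists>y \<in> carrier X. plus y x = e"
proof -
  have "(\<lambda>y. y \<star> x) ` carrier X = carrier X"
    using right_mult_aut[OF x] by (simp add: magma_aut_def bij_betw_def)
  then have "e \<in> (\<lambda>y. y \<star> x) ` carrier X" by simp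
  then obtain y where y: "y \<in> carrier X" "e = y \<star> x" by (rule imageE)
  have "plus y x = e"
    by (rule halve_injective) (use x y(1) in \<open>simp_all add: halve_plus halve_base flip: y(2)\<close>)
  with y(1) show ?thesis by (rule bexI[rotated])
qed

lemma plus_base:
  assumes "x \<in> carrier X"
  shows "plus e x = x"
proof (rule halve_injective)
  show "halve (plus e x) = halve x"
    using assms commutative[of e x] by (simp add: halve_plus) (simp add: halve_def)
qed (use assms in simp_all)

definition additive_group :: "'a ring" where
  "additive_group =
     \<lparr> carrier = carrier X, mult = undefined, one = undefined, zero = e, add = plus \<rparr>"

lemma additive_group_simps [simp]:
  "carrier additive_group = carrier X" "zero additive_group = e" "add additive_group = plus"
  by (simp_all add: additive_group_def)

lemma uniquely_two_divisible_additive_group: "uniquely_two_divisible_group additive_group"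
proof (intro uniquely_two_divisible_group.intro uniquely_two_divisible_group_axioms.intro)
  show "abelian_group additive_group"
    by (rule abelian_groupI, unfold additive_group_simps)
      (simp_all add: plus_assoc plus_base ex_negative, rule plus_commute)
  show "bij_betw (\<lambda>x. x \<oplus>\<^bsub>additive_group\<^esub> x) (carrier additive_group) (carrier additive_group)"
    by (rule bij_betw_byWitness[where f' = halve])
      (auto simp: plus_halve_halve halve_plus qop_idem)
qed

sublocale additive: uniquely_two_divisible_group additive_group
  by (rule uniquely_two_divisible_additive_group)

lemma midpoint_additive_group:
  assumes "x \<in> carrier X" "y \<in> carrier X"
  shows "qop (midpoint_quandle (Some additive.dyadic_module_of)) x y = x \<star> y"
  using assms additive.dyadic_smult_half[of "plus x y" "x \<star> y"] plus_halve_halve[of "plus x y"]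
  by (simp add: halve_plus qop_closed)

end

text \<open>
  A magma has arbitrary values of its operation outside the carrier, so a midpoint quandle recovers
  a given quandle only up to those values. Homomorphisms do not see them.
\<close>

definition same_magma :: "'a magma \<Rightarrow> 'a magma \<Rightarrow> bool" where
  "same_magma X Y \<longleftrightarrow> carrier X = carrier Y \<and>
     (\<forall>x \<in> carrier X. \<forall>y \<in> carrier X. x \<star>\<^bsub>X\<^esub> y = x \<star>\<^bsub>Y\<^esub> y)"

lemma same_magma_sym: "same_magma X Y \<Longrightarrow> same_magma Y X"
  by (simp add: same_magma_def)

lemma magma_hom_same_magma:
  assumes "same_magma X X'" "same_magma Y Y'"
  shows "magma_hom X Y = magma_hom X' Y'"
  using assms by (fastforce simp: magma_hom_def same_magma_def Pi_def)

lemma mc_quandle_is_midpoint_quandle: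
  assumes X: "medial_commutative_quandle X"
  shows "\<exists>A \<in> Obj (AffMod dyadic_ring). same_magma (midpoint_quandle A) X"
proof (cases "carrier X = {}")
  case True
  then show ?thesis by (intro bexI[of _ None]) (auto simp: AffMod_def same_magma_def)
next
  case False
  then obtain e where e: "e \<in> carrier X" by auto
  interpret pointed_mc_quandle X e
    by (intro pointed_mc_quandle.intro pointed_mc_quandle_axioms.intro X e)
  show ?thesis
  proof (rule bexI)
    show "same_magma (midpoint_quandle (Some additive.dyadic_module_of)) X"
      unfolding same_magma_def using midpoint_additive_group
      by (simp del: midpoint_quandle.simps)
    show "Some additive.dyadic_module_of \<in> Obj (AffMod dyadic_ring)"
      using additive.module_dyadic_module_of by (simp add: AffMod_def)
  qed
qed

section \<open>The equivalence\<close>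

lemma Obj_MCQnd: "X \<in> Obj MCQnd \<longleftrightarrow> medial_commutative_quandle X"
  by (simp add: MCQnd_def)

lemma MCQnd_simps:
  "Hom MCQnd X Y = magma_hom X Y \<inter> extensional (carrier X)"
  "Ident MCQnd X = (\<lambda>x \<in> carrier X. x)"
  "Comp MCQnd X Y Z g f = compose (carrier X) g f"
  by (simp_all add: MCQnd_def)

lemma AffMod_simps:
  "Ident (AffMod R) A = (\<lambda>x \<in> underlying A. x)"
  "Comp (AffMod R) A B C g f = compose (underlying A) g f"
  by (simp_all add: AffMod_def)

lemma Hom_AffMod:
  assumes "A \<in> Obj (AffMod dyadic_ring)" "B \<in> Obj (AffMod dyadic_ring)"
  shows "Hom (AffMod dyadic_ring) A B = Hom MCQnd (midpoint_quandle A) (midpoint_quandle B)"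
  using affine_maps_eq_midpoint_homs[OF assms] by (simp add: MCQnd_simps) (simp add: AffMod_def)

lemma midpoint_quandle_in_MCQnd:
  assumes "A \<in> Obj (AffMod dyadic_ring)"
  shows "midpoint_quandle A \<in> Obj MCQnd"
  using assms
proof (cases A rule: AffMod_obj_cases)
  case 1
  then show ?thesis
    unfolding Obj_MCQnd by unfold_locales auto
next
  case (2 M)
  then show ?thesis
    using dyadic_module.medial_commutative_midpoint_quandle by (simp only: Obj_MCQnd)
qed

lemma identity_in_Hom_MCQnd:
  assumes "medial_commutative_quandle X" "same_magma X Y"
  shows "(\<lambda>x \<in> carrier X. x) \<in> Hom MCQnd X Y"
proof -
  interpret medial_commutative_quandle X by (rule assms)
  show ?thesis using assms(2) qop_closed by (auto simp: MCQnd_simps magma_hom_def same_magma_def)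
qed

lemma compose_identity:
  assumes "f \<in> A \<rightarrow> B" "f \<in> extensional A"
  shows "compose A f (\<lambda>x \<in> A. x) = f" "compose A (\<lambda>x \<in> B. x) f = f"
  using assms by (auto simp: compose_def fun_eq_iff extensional_def)

lemma category_MCQnd: "is_category (MCQnd :: ('a magma, 'a \<Rightarrow> 'a) category)"
proof
  fix A :: "'a magma" assume A: "A \<in> Obj MCQnd"
  then show "Ident MCQnd A \<in> Hom MCQnd A A"
    using identity_in_Hom_MCQnd[of A A] by (simp add: Obj_MCQnd MCQnd_simps same_magma_def)
next
  fix A B D :: "'a magma" and f g
  assume "A \<in> Obj MCQnd" "f \<in> Hom MCQnd A B" "g \<in> Hom MCQnd B D"
  then interpret medial_commutative_quandle A by (simp add: Obj_MCQnd)
  show "Comp MCQnd A B D g f \<in> Hom MCQnd A D"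
    using \<open>f \<in> Hom MCQnd A B\<close> \<open>g \<in> Hom MCQnd B D\<close> qop_closed
    by (auto simp: MCQnd_simps magma_hom_def compose_def Pi_def)
next
  fix A B D E :: "'a magma" and f g h
  assume "f \<in> Hom MCQnd A B"
  then show "Comp MCQnd A D E h (Comp MCQnd A B D g f) = Comp MCQnd A B E (Comp MCQnd B D E h g) f"
    by (auto simp: MCQnd_simps magma_hom_def compose_def fun_eq_iff)
qed (auto simp: MCQnd_simps magma_hom_def compose_identity)

text \<open>
  The category laws pull back along any map on objects. Applied to \<open>midpoint_quandle\<close>, this spares
  a verification that affine maps compose: homomorphisms of midpoint quandles do.
\<close>

lemma is_category_pullback:
  assumes D: "is_category D"
    and obj: "\<And>A. A \<in> Obj C \<Longrightarrow> F A \<in> Obj D"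
    and hom: "\<And>A B. \<lbrakk> A \<in> Obj C; B \<in> Obj C \<rbrakk> \<Longrightarrow> Hom C A B = Hom D (F A) (F B)"
    and ident: "\<And>A. Ident C A = Ident D (F A)"
    and comp: "\<And>A B E. Comp C A B E = Comp D (F A) (F B) (F E)"
  shows "is_category C"
proof -
  interpret D: is_category D by (rule D)
  show ?thesis
    by unfold_locales
      (simp_all add: obj hom ident comp D.ident_in_hom D.comp_in_hom D.comp_ident D.ident_comp D.comp_assoc)
qed

lemma category_AffMod:
  "is_category (AffMod dyadic_ring :: ((rat, 'a) module option, 'a \<Rightarrow> 'a) category)"
  by (rule is_category_pullback[OF category_MCQnd, of _ midpoint_quandle])
    (simp_all add: midpoint_quandle_in_MCQnd Hom_AffMod, simp_all add: AffMod_simps MCQnd_simps fun_eq_iff)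

lemma functor_mid:
  "is_functor (AffMod dyadic_ring) MCQnd
    (mid :: ((rat, 'a) module option, 'a \<Rightarrow> 'a, 'a magma, 'a \<Rightarrow> 'a) cfunctor)"
  by (intro is_functor.intro is_functor_axioms.intro category_AffMod category_MCQnd)
    (simp_all add: mid_def midpoint_quandle_in_MCQnd Hom_AffMod, simp_all add: AffMod_simps MCQnd_simps)

text \<open>
  For a nonempty quandle this involves the choice of a zero; different choices give different
  modules with the same affine maps.
\<close>

definition module_of_quandle :: "'a magma \<Rightarrow> (rat, 'a) module option" where
  "module_of_quandle X =
     (SOME A. A \<in> Obj (AffMod dyadic_ring) \<and> same_magma (midpoint_quandle A) X)"

lemma module_of_quandle:
  assumes "X \<in> Obj MCQnd"
  shows "module_of_quandle X \<in> Obj (AffMod dyadic_ring)"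
    and "same_magma (midpoint_quandle (module_of_quandle X)) X"
  using someI_ex[of "\<lambda>A. A \<in> Obj (AffMod dyadic_ring) \<and> same_magma (midpoint_quandle A) X"]
    mc_quandle_is_midpoint_quandle[of X] assms
  by (auto simp: module_of_quandle_def Obj_MCQnd)

lemma underlying_module_of_quandle:
  "X \<in> Obj MCQnd \<Longrightarrow> underlying (module_of_quandle X) = carrier X"
  using module_of_quandle[of X] by (simp add: same_magma_def)

lemma Hom_module_of_quandle:
  assumes "X \<in> Obj MCQnd" "Y \<in> Obj MCQnd"
  shows "Hom (AffMod dyadic_ring) (module_of_quandle X) (module_of_quandle Y) = Hom MCQnd X Y"
proof -
  let ?A = "module_of_quandle X" and ?B = "module_of_quandle Y"
  have "Hom (AffMod dyadic_ring) ?A ?B = Hom MCQnd (midpoint_quandle ?A) (midpoint_quandle ?B)"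
    by (rule Hom_AffMod[OF module_of_quandle(1)[OF assms(1)] module_of_quandle(1)[OF assms(2)]])
  also have "\<dots> = Hom MCQnd X Y"
    using magma_hom_same_magma[OF module_of_quandle(2)[OF assms(1)] module_of_quandle(2)[OF assms(2)]]
    by (simp add: MCQnd_simps underlying_module_of_quandle[OF assms(1)])
  finally show ?thesis .
qed

definition quandle_to_module ::
  "('a magma, 'a \<Rightarrow> 'a, (rat, 'a) module option, 'a \<Rightarrow> 'a) cfunctor" where
  "quandle_to_module = \<lparr> omap = module_of_quandle, amap = (\<lambda>X Y f. f) \<rparr>"

lemma functor_quandle_to_module:
  "is_functor MCQnd (AffMod dyadic_ring)
    (quandle_to_module :: ('a magma, 'a \<Rightarrow> 'a, (rat, 'a) module option, 'a \<Rightarrow> 'a) cfunctor)"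
  by (intro is_functor.intro is_functor_axioms.intro category_AffMod category_MCQnd)
    (simp_all add: quandle_to_module_def module_of_quandle Hom_module_of_quandle,
     simp_all add: AffMod_simps MCQnd_simps underlying_module_of_quandle)

lemma iso_in_MCQnd_identity:
  assumes "X \<in> Obj MCQnd" "Y \<in> Obj MCQnd" "same_magma X Y"
  shows "iso_in MCQnd X Y (\<lambda>x \<in> carrier X. x)"
proof -
  have "carrier X = carrier Y" using assms(3) by (simp add: same_magma_def)
  moreover have "(\<lambda>x \<in> carrier X. x) \<in> Hom MCQnd X Y" "(\<lambda>x \<in> carrier Y. x) \<in> Hom MCQnd Y X"
    using assms identity_in_Hom_MCQnd same_magma_sym by (auto simp: Obj_MCQnd)
  ultimately show ?thesis
    unfolding iso_in_def
    by (intro conjI bexI[of _ "\<lambda>x \<in> carrier Y. x"]) (simp_all add: MCQnd_simps compose_def fun_eq_iff)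
qed

lemma iso_in_AffMod_iff:
  assumes "A \<in> Obj (AffMod dyadic_ring)" "B \<in> Obj (AffMod dyadic_ring)"
  shows "iso_in (AffMod dyadic_ring) A B f \<longleftrightarrow>
    iso_in MCQnd (midpoint_quandle A) (midpoint_quandle B) f"
  using assms by (simp add: iso_in_def Hom_AffMod) (simp add: AffMod_simps MCQnd_simps)

lemma compose_identity_MCQnd:
  assumes "f \<in> Hom MCQnd X Y"
  shows "compose (carrier X) (\<lambda>x \<in> carrier Y. x) f = compose (carrier X) f (\<lambda>x \<in> carrier X. x)"
  using assms compose_identity[of f "carrier X" "carrier Y"] by (simp add: MCQnd_simps magma_hom_def)

theorem corollary5p4:
  shows "is_equivalence
    (AffMod dyadic_ring :: ((rat, 'a) module option, 'a \<Rightarrow> 'a) category)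
    (MCQnd :: ('a magma, 'a \<Rightarrow> 'a) category)
    mid"
  unfolding is_equivalence_def
proof (intro conjI functor_mid exI)
  show "is_functor MCQnd (AffMod dyadic_ring)
      (quandle_to_module :: ('a magma, 'a \<Rightarrow> 'a, (rat, 'a) module option, 'a \<Rightarrow> 'a) cfunctor)"
    by (rule functor_quandle_to_module)
  show "natural_iso (AffMod dyadic_ring) (AffMod dyadic_ring) id_functor
      (comp_functor quandle_to_module
        (mid :: ((rat, 'a) module option, 'a \<Rightarrow> 'a, 'a magma, 'a \<Rightarrow> 'a) cfunctor))
      (\<lambda>A. \<lambda>x \<in> underlying A. x)"
    unfolding natural_iso_def id_functor_def comp_functor_def quandle_to_module_def mid_def
      cfunctor.simps
  proof (intro conjI ballI)
    fix A :: "(rat, 'a) module option" assume A: "A \<in> Obj (AffMod dyadic_ring)"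
    let ?Q = "midpoint_quandle A"
    have Q: "?Q \<in> Obj MCQnd" by (rule midpoint_quandle_in_MCQnd[OF A])
    show "iso_in (AffMod dyadic_ring) A (module_of_quandle ?Q) (\<lambda>x \<in> underlying A. x)"
      using iso_in_MCQnd_identity[of ?Q "midpoint_quandle (module_of_quandle ?Q)"]
        A Q module_of_quandle[OF Q]
      by (simp add: iso_in_AffMod_iff midpoint_quandle_in_MCQnd same_magma_sym)
  next
    fix A B :: "(rat, 'a) module option" and f
    assume "A \<in> Obj (AffMod dyadic_ring)" "B \<in> Obj (AffMod dyadic_ring)"
      "f \<in> Hom (AffMod dyadic_ring) A B"
    then show "Comp (AffMod dyadic_ring) A B (module_of_quandle (midpoint_quandle B))
          (\<lambda>x \<in> underlying B. x) f =
        Comp (AffMod dyadic_ring) A (module_of_quandle (midpoint_quandle A))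
          (module_of_quandle (midpoint_quandle B)) f (\<lambda>x \<in> underlying A. x)"
      using compose_identity_MCQnd[of f "midpoint_quandle A" "midpoint_quandle B"]
      by (simp add: AffMod_simps Hom_AffMod)
  qed
  show "natural_iso MCQnd MCQnd
      (comp_functor
        (mid :: ((rat, 'a) module option, 'a \<Rightarrow> 'a, 'a magma, 'a \<Rightarrow> 'a) cfunctor)
        quandle_to_module)
      id_functor (\<lambda>X. \<lambda>x \<in> carrier X. x)"
    unfolding natural_iso_def id_functor_def comp_functor_def quandle_to_module_def mid_def
      cfunctor.simps
  proof (intro conjI ballI)
    fix X :: "'a magma" assume X: "X \<in> Obj MCQnd"
    show "iso_in MCQnd (midpoint_quandle (module_of_quandle X)) X (\<lambda>x \<in> carrier X. x)"
      using iso_in_MCQnd_identity[of "midpoint_quandle (module_of_quandle X)" X]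
        X module_of_quandle[OF X] underlying_module_of_quandle[OF X]
      by (simp add: midpoint_quandle_in_MCQnd)
  next
    fix X Y :: "'a magma" and f
    assume "X \<in> Obj MCQnd" "Y \<in> Obj MCQnd" "f \<in> Hom MCQnd X Y"
    then show "Comp MCQnd (midpoint_quandle (module_of_quandle X))
          (midpoint_quandle (module_of_quandle Y)) Y (\<lambda>x \<in> carrier Y. x) f =
        Comp MCQnd (midpoint_quandle (module_of_quandle X)) X Y f (\<lambda>x \<in> carrier X. x)"
      using compose_identity_MCQnd[of f X Y] underlying_module_of_quandle[of X]
      by (simp add: MCQnd_simps)
  qed
qed

end
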